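(* For $0<\delta\le 1/4$ let $$H=\begin{bmatrix}1&1\\1&1\end{bmatrix},\qquad a=\begin{bmatrix}1\\1+\delta\end{bmatrix},\qquad r=\frac1{1+\delta},\qquad \mathcal{B}=[0,1]\times[0,r],$$ and $f(x)=\tfrac12x^\top Hx-a^\top x$. Let $g(x)=Hx-a$, and let $\Delta$, the cyclic sweep map $\mathcal{C}$ (coordinate order $1,2$) and the worst-case contraction $\chi_*$ be as in the context. Then: (1) The unique minimizer of $f$ over $\mathcal{B}$ is $x_*=(1-r,r)^\top$, and $g(x_* )=(0,-\delta)^\top$. (2) $$\chi_*=1-\frac{\delta}{2r}.$$ (3) The point $(1,0)^\top$ attains the worst-case ratio: $\Delta(\mathcal{C}((1,0)^\top))/\Delta((1,0)^\top)=\chi_*$. (4) Starting from $x^{(0)}=(1,0)^\top$, the sweeps $x^{(k)}=\mathcal{C}^k(x^{(0)})$ first reach $x_*$ at exactly $k=\lceil r/\delta\rceil+1$, and more than $\lfloor r/(2\delta)\rfloor$ sweeps are needed to halve the initial gap, i.e. $\Delta(x^{(k)})>\tfrac12\Delta(x^{(0)})$ for every integer $0\le k\le\lfloor r/(2\delta)\rfloor$. (5) Let $M_{\rm scr}=H+2\,\mathrm{diag}(0,\delta/r)$, let $T=\begin{bmatrix}0&0\\1&0\end{bmatrix}$ be the strictly lower triangular part of $H$, and let $A_{1/2}(M_{\rm scr})=2\lambda_{\max}\!\big(T(H+\tfrac12M_{\rm scr})^{-1}T^\top\big)$. Then $$\chi_*\le\frac{A_{1/2}(M_{\rm scr})}{1+A_{1/2}(M_{\rm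 scr})}=1-\frac{3\delta}{6r+7\delta}, \qquad\text{and}\qquad \frac{3\delta/(6r+7\delta)}{1-\chi_*}\longrightarrow1\quad\text{as }\delta\downarrow0,$$ where $r=1/(1+\delta)$ and $\chi_*$ depend on $\delta$.
   Context: $\lambda_{\max}$ is the largest eigenvalue of a symmetric matrix. $X_*=\arg\min_{x\in\mathcal{B}}f(x)$, $f_*=\min_{x\in\mathcal{B}}f(x)$, $\Delta(x)=f(x)-f_*$. Cyclic sweep (order $1,2$), with side lengths $r_1=1$, $r_2=r$: given $x\in\mathcal{B}$, first replace coordinate 1 by $\min\{r_1,\max\{0,\,x_1-g_1(x)\}\}$ to get $x^1$; then replace coordinate 2 of $x^1$ by $\min\{r_2,\max\{0,\,x^1_2-g_2(x^1)\}\}$ to get $x^2=:\mathcal{C}(x)$. (Each update is the exact minimization of $f$ in that coordinate over its interval.) $\mathcal{C}^k$ is the $k$-fold iterate. The worst-case one-sweep objective contraction is $$\chi_*:=\sup_{x\in\mathcal{B}\setminus X_*}\frac{\Delta(\mathcal{C}(x))}{\Delta(x)}.$$ *)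

theory Defs
  imports "HOL-Analysis.Analysis"
begin

definition quad_obj :: "real^'n^'n \<Rightarrow> real^'n \<Rightarrow> real^'n \<Rightarrow> real" where
  "quad_obj H a x = (1/2) * (x \<bullet> (H *v x)) - a \<bullet> x"

definition quad_grad :: "real^'n^'n \<Rightarrow> real^'n \<Rightarrow> real^'n \<Rightarrow> real^'n" where
  "quad_grad H a x = H *v x - a"

definition minimizers :: "('a \<Rightarrow> real) \<Rightarrow> 'a set \<Rightarrow> 'a set" where
  "minimizers f B = {x. is_arg_min f (\<lambda>y. y \<in> B) x}"

(* LEAST is the minimum of the image; it is meaningful only when f attains its minimum on B. *)
definition min_value :: "('a \<Rightarrow> real) \<Rightarrow> 'a set \<Rightarrow> real" where
  "min_value f B = (LEAST v. v \<in> f ` B)"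

definition gap :: "('a \<Rightarrow> real) \<Rightarrow> 'a set \<Rightarrow> 'a \<Rightarrow> real" where
  "gap f B x = f x - min_value f B"

(* The step length is 1, so this is exact coordinate minimization only when H $ i $ i = 1. *)
definition coord_update ::
  "real^'n^'n \<Rightarrow> real^'n \<Rightarrow> real^'n \<Rightarrow> 'n \<Rightarrow> real^'n \<Rightarrow> real^'n" where
  "coord_update H a s i x =
     (\<chi> j. if j = i then min (s $ i) (max 0 (x $ i - quad_grad H a x $ i)) else x $ j)"

definition cyclic_sweep ::
  "real^2^2 \<Rightarrow> real^2 \<Rightarrow> real^2 \<Rightarrow> real^2 \<Rightarrow> real^2" where
  "cyclic_sweep H a s x = coord_update H a s 2 (coord_update H a s 1 x)"

definition worst_contraction :: "('a \<Rightarrow> real) \<Rightarrow> 'a set \<Rightarrow> ('a \<Rightarrow> 'a) \<Rightarrow> real" where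
  "worst_contraction f B C = (SUP x \<in> B - minimizers f B. gap f B (C x) / gap f B x)"

definition lambda_max :: "real^'n^'n \<Rightarrow> real" where
  "lambda_max A = (GREATEST l. \<exists>v. v \<noteq> 0 \<and> A *v v = l *\<^sub>R v)"

definition diag :: "real^'n \<Rightarrow> real^'n^'n" where
  "diag d = (\<chi> i j. if i = j then d $ i else 0)"

(* Restricted to the index type 2 and not phrased with its order, in which 2 = 0 < 1. *)
definition strict_lower :: "real^2^2 \<Rightarrow> real^2^2" where
  "strict_lower A = (\<chi> i j. if i = 2 \<and> j = 1 then A $ i $ j else 0)"

definition A_half :: "real^2^2 \<Rightarrow> real^2^2 \<Rightarrow> real" where
  "A_half H M =
     2 * lambda_max (strict_lower H ** matrix_inv (H + (1/2) *\<^sub>R M) ** transpose (strict_lower H))"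


definition H_ex :: "real^2^2" where
  "H_ex = vector [vector [1, 1], vector [1, 1]]"

definition a_ex :: "real \<Rightarrow> real^2" where
  "a_ex \<delta> = vector [1, 1 + \<delta>]"

definition r_ex :: "real \<Rightarrow> real" where
  "r_ex \<delta> = 1 / (1 + \<delta>)"

definition sides_ex :: "real \<Rightarrow> real^2" where
  "sides_ex \<delta> = vector [1, r_ex \<delta>]"

(* On real^2, cbox is the coordinatewise box [0,1] x [0,r]. *)
definition B_ex :: "real \<Rightarrow> (real^2) set" where
  "B_ex \<delta> = cbox 0 (sides_ex \<delta>)"

definition f_ex :: "real \<Rightarrow> real^2 \<Rightarrow> real" where
  "f_ex \<delta> = quad_obj H_ex (a_ex \<delta>)"

definition g_ex :: "real \<Rightarrow> real^2 \<Rightarrow> real^2" where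
  "g_ex \<delta> = quad_grad H_ex (a_ex \<delta>)"

definition gap_ex :: "real \<Rightarrow> real^2 \<Rightarrow> real" where
  "gap_ex \<delta> = gap (f_ex \<delta>) (B_ex \<delta>)"

definition C_ex :: "real \<Rightarrow> real^2 \<Rightarrow> real^2" where
  "C_ex \<delta> = cyclic_sweep H_ex (a_ex \<delta>) (sides_ex \<delta>)"

definition chi_ex :: "real \<Rightarrow> real" where
  "chi_ex \<delta> = worst_contraction (f_ex \<delta>) (B_ex \<delta>) (C_ex \<delta>)"

definition xmin_ex :: "real \<Rightarrow> real^2" where
  "xmin_ex \<delta> = vector [1 - r_ex \<delta>, r_ex \<delta>]"

definition x0_ex :: "real^2" where
  "x0_ex = vector [1, 0]"

definition M_scr :: "real \<Rightarrow> real^2^2" where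
  "M_scr \<delta> = H_ex + 2 *\<^sub>R diag (vector [0, \<delta> / r_ex \<delta>])"

end

theory Submission
  imports Defs
begin

text \<open>
  In the coordinates \<open>s = x\<^sub>1 + x\<^sub>2 - 1\<close> and \<open>w = r - x\<^sub>2\<close> the gap is \<open>s\<^sup>2 / 2 + \<delta> w\<close>,
  and a sweep sends \<open>(s, w)\<close> to \<open>(min w \<delta>, max 0 (w - \<delta>))\<close>. So each sweep raises \<open>x\<^sub>2\<close> by at
  most \<open>\<delta>\<close>, and the ratio, at most \<open>1 - \<delta> / (2 w)\<close> for \<open>w \<ge> \<delta>\<close> and at most \<open>1/2\<close> for
  \<open>w < \<delta>\<close>, is worst for \<open>s = 0\<close> and \<open>w = r\<close>.
\<close>

section \<open>Closed form of the gap and the unique minimizer\<close>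

lemma r_ex_bounds:
  assumes "0 < \<delta>" "\<delta> \<le> 1/4"
  shows "0 < r_ex \<delta>" "r_ex \<delta> < 1" "\<delta> \<le> r_ex \<delta>"
proof -
  \<comment> \<open>The right side is 5/16, below 1, and \<open>\<delta> \<le> r_ex \<delta>\<close>
    means exactly \<open>\<delta> * (1 + \<delta>) \<le> 1\<close>.\<close>
  have "\<delta> * (1 + \<delta>) \<le> (1/4) * (1 + 1/4)"
    using assms by (intro mult_mono) auto
  then show "\<delta> \<le> r_ex \<delta>"
    using assms by (simp add: r_ex_def field_simps)
qed (use assms in \<open>auto simp: r_ex_def\<close>)

lemma mem_B_ex:
  "x \<in> B_ex \<delta> \<longleftrightarrow> 0 \<le> x $ 1 \<and> x $ 1 \<le> 1 \<and> 0 \<le> x $ 2 \<and> x $ 2 \<le> r_ex \<delta>"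
  by (auto simp: B_ex_def sides_ex_def mem_box_cart forall_2)

text \<open>\<open>H_ex\<close> has all entries 1, so the quadratic form is the square of x1 + x2,
  and completing that square leaves only a linear term in x2. On the box the first two summands are
  nonnegative and both vanish at \<open>xmin_ex\<close>, so the constants are the minimum.\<close>

lemma f_ex_eq:
  "f_ex \<delta> x = (x $ 1 + x $ 2 - 1)\<^sup>2 / 2 + \<delta> * (r_ex \<delta> - x $ 2) - 1/2 - \<delta> * r_ex \<delta>"
  by (simp add: f_ex_def quad_obj_def H_ex_def a_ex_def inner_vec_def matrix_vector_mult_def
      sum_2 power2_eq_square field_simps)

lemma xmin_ex_mem_B_ex:
  assumes "0 < \<delta>" "\<delta> \<le> 1/4"
  shows "xmin_ex \<delta> \<in> B_ex \<delta>"
  using r_ex_bounds[OF assms] by (auto simp: mem_B_ex xmin_ex_def)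

lemma f_ex_xmin: "f_ex \<delta> (xmin_ex \<delta>) = - 1/2 - \<delta> * r_ex \<delta>"
  by (simp add: f_ex_eq xmin_ex_def)

lemma f_ex_xmin_le:
  assumes "0 < \<delta>" "x \<in> B_ex \<delta>"
  shows "f_ex \<delta> (xmin_ex \<delta>) \<le> f_ex \<delta> x"
  using assms unfolding f_ex_xmin by (simp add: f_ex_eq mem_B_ex)

lemma gap_ex_eq:
  assumes "0 < \<delta>" "\<delta> \<le> 1/4"
  shows "gap_ex \<delta> x = (x $ 1 + x $ 2 - 1)\<^sup>2 / 2 + \<delta> * (r_ex \<delta> - x $ 2)"
proof -
  have "min_value (f_ex \<delta>) (B_ex \<delta>) = f_ex \<delta> (xmin_ex \<delta>)"
    unfolding min_value_def
    using xmin_ex_mem_B_ex[OF assms] f_ex_xmin_le[OF assms(1)]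
    by (intro Least_equality) auto
  then show ?thesis
    unfolding gap_ex_def gap_def f_ex_xmin by (simp add: f_ex_eq)
qed

lemma gap_ex_pos:
  assumes "0 < \<delta>" "\<delta> \<le> 1/4" "x \<in> B_ex \<delta>" "x \<noteq> xmin_ex \<delta>"
  shows "0 < gap_ex \<delta> x"
proof (cases "x $ 2 = r_ex \<delta>")
  case True
  with assms(4) have "x $ 1 + x $ 2 - 1 \<noteq> 0"
    by (auto simp: xmin_ex_def vec_eq_iff forall_2)
  then have "0 < (x $ 1 + x $ 2 - 1)\<^sup>2"
    by simp
  with True show ?thesis
    by (simp add: gap_ex_eq[OF assms(1,2)])
next
  case False
  with assms show ?thesis
    by (simp add: gap_ex_eq[OF assms(1,2)] mem_B_ex add_nonneg_pos)
qed

lemma minimizers_ex: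
  assumes "0 < \<delta>" "\<delta> \<le> 1/4"
  shows "minimizers (f_ex \<delta>) (B_ex \<delta>) = {xmin_ex \<delta>}"
proof -
  have "f_ex \<delta> (xmin_ex \<delta>) < f_ex \<delta> x" if "x \<in> B_ex \<delta>" "x \<noteq> xmin_ex \<delta>" for x
    using gap_ex_pos[OF assms that] unfolding gap_ex_eq[OF assms] f_ex_xmin
    by (simp add: f_ex_eq)
  then show ?thesis
    using xmin_ex_mem_B_ex[OF assms] f_ex_xmin_le[OF assms(1)]
    by (force simp: minimizers_def is_arg_min_linorder)
qed

lemma g_ex_xmin: "g_ex \<delta> (xmin_ex \<delta>) = vector [0, - \<delta>]"
  by (simp add: g_ex_def quad_grad_def H_ex_def a_ex_def xmin_ex_def vec_eq_iff forall_2
      matrix_vector_mult_def sum_2)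

section \<open>One sweep and the gap after it\<close>

lemma C_ex_components:
  assumes "0 < \<delta>" "\<delta> \<le> 1/4" "x \<in> B_ex \<delta>"
  shows "C_ex \<delta> x $ 1 = 1 - x $ 2" "C_ex \<delta> x $ 2 = min (r_ex \<delta>) (x $ 2 + \<delta>)"
  \<comment> \<open>The clamp on coordinate 1 is inactive because 1 - x2 lies in [0,1]. After that
    update the second gradient entry is \<open>- \<delta>\<close>, so only the upper bound on
    coordinate 2 can bind.\<close>
  using assms r_ex_bounds[OF assms(1,2)]
  by (auto simp: C_ex_def cyclic_sweep_def coord_update_def quad_grad_def H_ex_def a_ex_def
      sides_ex_def matrix_vector_mult_def sum_2 mem_B_ex)

lemma C_ex_mem_B_ex:
  assumes "0 < \<delta>" "\<delta> \<le> 1/4" "x \<in> B_ex \<delta>"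
  shows "C_ex \<delta> x \<in> B_ex \<delta>"
  using assms(1,3) r_ex_bounds[OF assms(1,2)] unfolding mem_B_ex C_ex_components[OF assms]
  by auto

lemma gap_ex_C_ex:
  assumes "0 < \<delta>" "\<delta> \<le> 1/4" "x \<in> B_ex \<delta>"
  shows "gap_ex \<delta> (C_ex \<delta> x) =
    (if \<delta> \<le> r_ex \<delta> - x $ 2 then \<delta> * (r_ex \<delta> - x $ 2) - \<delta>\<^sup>2 / 2
     else (r_ex \<delta> - x $ 2)\<^sup>2 / 2)"
  unfolding gap_ex_eq[OF assms(1,2)] C_ex_components[OF assms]
  by (auto simp: min_def power2_eq_square algebra_simps)

text \<open>The new gap depends on x only through w, so it suffices to compare it with the linear
  part \<open>\<delta> * w\<close> of the old gap. The product form also covers the minimizer, where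
  the ratio would divide by 0.\<close>

lemma gap_ex_C_ex_le:
  assumes "0 < \<delta>" "\<delta> \<le> 1/4" "x \<in> B_ex \<delta>"
  shows "gap_ex \<delta> (C_ex \<delta> x) \<le> (1 - \<delta> / (2 * r_ex \<delta>)) * gap_ex \<delta> x"
proof -
  define r where "r = r_ex \<delta>"
  define w where "w = r - x $ 2"
  note r = r_ex_bounds[OF assms(1,2), folded r_def]
  have w: "0 \<le> w" "w \<le> r"
    using assms(3) by (auto simp: mem_B_ex w_def r_def)
  have half: "\<delta> / (2 * r) \<le> 1/2"
    using r by (simp add: field_simps)
  have "gap_ex \<delta> (C_ex \<delta> x) \<le> (1 - \<delta> / (2 * r)) * (\<delta> * w)"
  proof (cases "\<delta> \<le> w")
    case True
    \<comment> \<open>This is the only loss in this case, and it vanishes for w = r, the value at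
      (1,0).\<close>
    have "\<delta>\<^sup>2 * w \<le> \<delta>\<^sup>2 * r"
      using w by (simp add: mult_left_mono)
    then have "\<delta>\<^sup>2 / (2 * r) * w \<le> \<delta>\<^sup>2 / 2"
      using r by (simp add: field_simps)
    then show ?thesis
      using True unfolding gap_ex_C_ex[OF assms] w_def[unfolded r_def, symmetric]
      by (simp add: algebra_simps power2_eq_square)
  next
    case False
    \<comment> \<open>The last sweep contracts by at least 1/2, and \<open>half\<close> says that
      the claimed factor is no smaller than that.\<close>
    have "w * w / 2 \<le> (1/2) * (\<delta> * w)"
      using False w by (simp add: mult_right_mono)
    also have "\<dots> \<le> (1 - \<delta> / (2 * r)) * (\<delta> * w)"
      using half w assms(1) by (intro mult_right_mono) auto
    finally show ?thesis
      using False unfolding gap_ex_C_ex[OF assms] w_def[unfolded r_def, symmetric]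
      by (simp add: power2_eq_square)
  qed
  also have "\<dots> \<le> (1 - \<delta> / (2 * r)) * gap_ex \<delta> x"
    using half unfolding gap_ex_eq[OF assms(1,2)]
    by (intro mult_left_mono) (auto simp: w_def r_def)
  finally show ?thesis
    by (simp add: r_def)
qed

section \<open>The supremum, attained at (1,0)\<close>

lemma x0_ex_mem:
  assumes "0 < \<delta>" "\<delta> \<le> 1/4"
  shows "x0_ex \<in> B_ex \<delta>" "x0_ex \<noteq> xmin_ex \<delta>"
  using r_ex_bounds[OF assms]
  by (auto simp: x0_ex_def mem_B_ex xmin_ex_def vec_eq_iff forall_2)

lemma gap_ex_x0:
  assumes "0 < \<delta>" "\<delta> \<le> 1/4"
  shows "gap_ex \<delta> x0_ex = \<delta> * r_ex \<delta>"
  by (simp add: gap_ex_eq[OF assms] x0_ex_def)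

lemma ratio_x0_ex:
  assumes "0 < \<delta>" "\<delta> \<le> 1/4"
  shows "gap_ex \<delta> (C_ex \<delta> x0_ex) / gap_ex \<delta> x0_ex = 1 - \<delta> / (2 * r_ex \<delta>)"
  using r_ex_bounds[OF assms] assms
  unfolding gap_ex_C_ex[OF assms x0_ex_mem(1)[OF assms]] gap_ex_x0[OF assms]
  by (simp add: x0_ex_def field_simps power2_eq_square)

lemma ratio_le:
  assumes "0 < \<delta>" "\<delta> \<le> 1/4" "x \<in> B_ex \<delta> - minimizers (f_ex \<delta>) (B_ex \<delta>)"
  shows "gap_ex \<delta> (C_ex \<delta> x) / gap_ex \<delta> x \<le> 1 - \<delta> / (2 * r_ex \<delta>)"
  using assms gap_ex_pos[of \<delta> x] gap_ex_C_ex_le[of \<delta> x]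
  by (simp add: minimizers_ex pos_divide_le_eq)

text \<open>Certifies that the \<open>SUP\<close> behind \<open>chi_ex\<close> is a genuine
  supremum. The singleton is written out to match the goal once \<open>minimizers_ex\<close> has
  rewritten it.\<close>

lemma bdd_above_ratio:
  assumes "0 < \<delta>" "\<delta> \<le> 1/4"
  shows "bdd_above ((\<lambda>x. gap_ex \<delta> (C_ex \<delta> x) / gap_ex \<delta> x) `
    (B_ex \<delta> - {xmin_ex \<delta>}))"
  using ratio_le[OF assms, unfolded minimizers_ex[OF assms]] by (rule bdd_aboveI2)

lemma chi_ex_eq:
  assumes "0 < \<delta>" "\<delta> \<le> 1/4"
  shows "chi_ex \<delta> = 1 - \<delta> / (2 * r_ex \<delta>)"
  unfolding chi_ex_def worst_contraction_def gap_ex_def[symmetric]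
proof (rule cSup_eq_maximum)
  show "1 - \<delta> / (2 * r_ex \<delta>) \<in> (\<lambda>x. gap_ex \<delta> (C_ex \<delta> x) / gap_ex \<delta> x) `
      (B_ex \<delta> - minimizers (f_ex \<delta>) (B_ex \<delta>))"
    using x0_ex_mem[OF assms] ratio_x0_ex[OF assms] minimizers_ex[OF assms]
    by (intro image_eqI[of _ _ x0_ex]) auto
qed (use ratio_le[OF assms] in auto)

section \<open>The trajectory from (1,0)\<close>

lemma C_ex_iterate_mem:
  assumes "0 < \<delta>" "\<delta> \<le> 1/4"
  shows "(C_ex \<delta> ^^ k) x0_ex \<in> B_ex \<delta>"
  by (induction k) (use x0_ex_mem[OF assms] C_ex_mem_B_ex[OF assms] in auto)

lemma C_ex_iterate_2:
  assumes "0 < \<delta>" "\<delta> \<le> 1/4"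
  shows "(C_ex \<delta> ^^ k) x0_ex $ 2 = min (r_ex \<delta>) (real k * \<delta>)"
proof (induction k)
  case 0
  then show ?case
    using r_ex_bounds[OF assms] by (simp add: x0_ex_def)
next
  case (Suc k)
  then show ?case
    using assms(1) C_ex_components(2)[OF assms C_ex_iterate_mem[OF assms]]
    by (auto simp: min_def algebra_simps)
qed

text \<open>Coordinate 1 is computed from the old x2, so it lags one sweep behind: the minimizer is
  reached one sweep after x2 hits its upper bound, hence the \<open>+ 1\<close>. The equivalence
  gives both the arrival and the failure of every earlier sweep.\<close>

lemma C_ex_iterate_eq_xmin_iff:
  assumes "0 < \<delta>" "\<delta> \<le> 1/4"
  shows "(C_ex \<delta> ^^ k) x0_ex = xmin_ex \<delta> \<longleftrightarrow> nat \<lceil>r_ex \<delta> / \<delta>\<rceil> + 1 \<le> k"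
proof (cases k)
  case 0
  then show ?thesis
    using x0_ex_mem[OF assms] by simp
next
  case (Suc m)
  have "(C_ex \<delta> ^^ k) x0_ex = xmin_ex \<delta> \<longleftrightarrow> r_ex \<delta> \<le> real m * \<delta>"
    using assms(1) C_ex_components[OF assms C_ex_iterate_mem[OF assms, of m]]
      C_ex_iterate_2[OF assms, of m]
    by (auto simp: Suc xmin_ex_def vec_eq_iff forall_2 min_def)
  also have "\<dots> \<longleftrightarrow> r_ex \<delta> / \<delta> \<le> real m"
    using assms(1) by (simp add: pos_divide_le_eq)
  also have "\<dots> \<longleftrightarrow> nat \<lceil>r_ex \<delta> / \<delta>\<rceil> + 1 \<le> k"
    using Suc by (simp add: nat_le_iff ceiling_le_iff)
  finally show ?thesis .
qed

lemma half_gap_less: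
  assumes "0 < \<delta>" "\<delta> \<le> 1/4" and k: "int k \<le> \<lfloor>r_ex \<delta> / (2 * \<delta>)\<rfloor>"
  shows "(1/2) * gap_ex \<delta> x0_ex < gap_ex \<delta> ((C_ex \<delta> ^^ k) x0_ex)"
proof (cases k)
  case 0
  then show ?thesis
    using assms r_ex_bounds[OF assms(1,2)] by (simp add: gap_ex_x0)
next
  case (Suc m)
  have "real k \<le> r_ex \<delta> / (2 * \<delta>)"
    using k by (simp add: le_floor_iff)
  then have "real k * \<delta> \<le> r_ex \<delta> / 2"
    using assms(1) by (simp add: field_simps)
  \<comment> \<open>Hence the cap on x2 is inactive after m sweeps, and the next sweep is in the
    first branch of \<open>gap_ex_C_ex\<close>.\<close>
  then have m: "real m * \<delta> + \<delta> \<le> r_ex \<delta> / 2"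
    using Suc by (simp add: algebra_simps)
  then have x2: "(C_ex \<delta> ^^ m) x0_ex $ 2 = real m * \<delta>"
    using assms r_ex_bounds[OF assms(1,2)] by (simp add: C_ex_iterate_2)
  have "gap_ex \<delta> ((C_ex \<delta> ^^ k) x0_ex) = \<delta> * (r_ex \<delta> - real m * \<delta> - \<delta> / 2)"
    using m r_ex_bounds[OF assms(1,2)]
      gap_ex_C_ex[OF assms(1,2) C_ex_iterate_mem[OF assms(1,2), of m]]
    by (simp add: Suc x2 power2_eq_square algebra_simps)
  \<comment> \<open>Strict because \<open>m\<close> leaves a slack of at least
    \<open>\<delta> / 2\<close> in the second factor.\<close>
  moreover have "\<delta> * (r_ex \<delta> / 2) < \<delta> * (r_ex \<delta> - real m * \<delta> - \<delta> / 2)"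
    using m assms(1) by (intro mult_strict_left_mono) auto
  ultimately show ?thesis
    unfolding gap_ex_x0[OF assms(1,2)] by simp
qed

section \<open>The matrix bound and its asymptotic sharpness\<close>

lemma strict_lower_H_ex: "strict_lower H_ex = vector [vector [0, 0], vector [1, 0]]"
  by (simp add: strict_lower_def H_ex_def vec_eq_iff forall_2)

text \<open>\<open>matrix_inv\<close> is a choice among two-sided inverses; exhibiting one
  determines it.\<close>

lemma matrix_inv_unique:
  fixes A B :: "real^'n^'n"
  assumes "A ** B = mat 1" "B ** A = mat 1"
  shows "invertible A" "matrix_inv A = B"
proof -
  show "invertible A"
    using assms by (auto simp: invertible_def)
  then have left_inv: "matrix_inv A ** A = mat 1"
    unfolding invertible_def matrix_inv_def by (rule someI2_ex) simp
  have "matrix_inv A = matrix_inv A ** (A ** B)"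
    by (simp add: assms)
  also have "\<dots> = B"
    by (simp add: matrix_mul_assoc left_inv)
  finally show "matrix_inv A = B" .
qed

text \<open>The matrix has all entries 3/2 except \<open>3/2 + 1/p\<close> in the lower right
  corner. Its determinant is \<open>3 / (2 * p)\<close>, and the adjugate formula gives
  \<open>N\<close>.\<close>

lemma inverse_H_plus_half_M_scr:
  assumes "0 < \<delta>" "\<delta> \<le> 1/4"
  defines "p \<equiv> r_ex \<delta> / \<delta>"
  defines "N \<equiv> vector [vector [p + 2/3, - p], vector [- p, p]] :: real^2^2"
  shows "invertible (H_ex + (1/2) *\<^sub>R M_scr \<delta>)"
    and "matrix_inv (H_ex + (1/2) *\<^sub>R M_scr \<delta>) = N"
proof -
  have "r_ex \<delta> \<noteq> 0"
    using r_ex_bounds[OF assms(1,2)] by simp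
  then have "(H_ex + (1/2) *\<^sub>R M_scr \<delta>) ** N = mat 1" "N ** (H_ex + (1/2) *\<^sub>R M_scr \<delta>) = mat 1"
    using assms(1)
    by (simp_all add: N_def p_def H_ex_def M_scr_def diag_def mat_def matrix_matrix_mult_def
        vec_eq_iff forall_2 sum_2 field_simps)
  then show "invertible (H_ex + (1/2) *\<^sub>R M_scr \<delta>)"
    and "matrix_inv (H_ex + (1/2) *\<^sub>R M_scr \<delta>) = N"
    by (rule matrix_inv_unique)+
qed

lemma lambda_max_diag_0:
  fixes c :: real
  assumes "0 \<le> c"
  shows "lambda_max (vector [vector [0, 0], vector [0, c]] :: real^2^2) = c"
  unfolding lambda_max_def
proof (rule Greatest_equality)
  show "\<exists>v. v \<noteq> 0 \<and> (vector [vector [0, 0], vector [0, c]] :: real^2^2) *v v = c *\<^sub>R v"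
    by (rule exI[of _ "vector [0, 1]"])
      (simp add: vec_eq_iff forall_2 matrix_vector_mult_def sum_2)
next
  fix l
  assume "\<exists>v. v \<noteq> 0 \<and> (vector [vector [0, 0], vector [0, c]] :: real^2^2) *v v = l *\<^sub>R v"
  then show "l \<le> c"
    \<comment> \<open>A nonzero v forces l = 0 or l = c; \<open>assms\<close> makes c the larger
      one.\<close>
    using assms by (auto simp: vec_eq_iff forall_2 matrix_vector_mult_def sum_2)
qed

lemma A_half_ex:
  assumes "0 < \<delta>" "\<delta> \<le> 1/4"
  shows "A_half H_ex (M_scr \<delta>) = 2 * (r_ex \<delta> / \<delta> + 2/3)"
proof -
  let ?p = "r_ex \<delta> / \<delta>"
  \<comment> \<open>Conjugation by T moves the upper left entry of the inverse to the lower right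
    and annihilates the rest.\<close>
  have "strict_lower H_ex ** matrix_inv (H_ex + (1/2) *\<^sub>R M_scr \<delta>) ** transpose (strict_lower H_ex)
      = vector [vector [0, 0], vector [0, ?p + 2/3]]"
    unfolding inverse_H_plus_half_M_scr(2)[OF assms] strict_lower_H_ex
    by (simp add: transpose_def matrix_matrix_mult_def vec_eq_iff forall_2 sum_2)
  then show ?thesis
    using r_ex_bounds[OF assms] assms(1) by (simp add: A_half_def lambda_max_diag_0)
qed

lemma A_half_bound_eq:
  assumes "0 < \<delta>" "\<delta> \<le> 1/4"
  shows "A_half H_ex (M_scr \<delta>) / (1 + A_half H_ex (M_scr \<delta>))
    = 1 - 3 * \<delta> / (6 * r_ex \<delta> + 7 * \<delta>)"
proof -
  have "0 < 6 * r_ex \<delta> + 7 * \<delta>"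
    using r_ex_bounds[OF assms] assms(1) by simp
  moreover have "A_half H_ex (M_scr \<delta>) = (6 * r_ex \<delta> + 4 * \<delta>) / (3 * \<delta>)"
    and "1 + A_half H_ex (M_scr \<delta>) = (6 * r_ex \<delta> + 7 * \<delta>) / (3 * \<delta>)"
    using assms(1) by (simp_all add: A_half_ex[OF assms] field_simps)
  then have "A_half H_ex (M_scr \<delta>) / (1 + A_half H_ex (M_scr \<delta>))
      = (6 * r_ex \<delta> + 4 * \<delta>) / (6 * r_ex \<delta> + 7 * \<delta>)"
    using assms(1) by simp
  ultimately show ?thesis
    by (simp add: field_simps)
qed

lemma rate_le:
  assumes "0 < \<delta>" "\<delta> \<le> 1/4"
  shows "3 * \<delta> / (6 * r_ex \<delta> + 7 * \<delta>) \<le> \<delta> / (2 * r_ex \<delta>)"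
proof -
  have "3 * \<delta> / (6 * r_ex \<delta> + 7 * \<delta>) \<le> 3 * \<delta> / (6 * r_ex \<delta>)"
    using r_ex_bounds[OF assms] assms(1) by (intro divide_left_mono) auto
  then show ?thesis
    by simp
qed

text \<open>For small positive \<open>\<delta>\<close> the factor \<open>\<delta>\<close> cancels
  and leaves \<open>6 * r / (6 * r + 7 * \<delta>)\<close>, where r tends to 1.\<close>

lemma rate_ratio_tendsto:
  "((\<lambda>\<delta>. (3 * \<delta> / (6 * r_ex \<delta> + 7 * \<delta>)) / (1 - chi_ex \<delta>)) \<longlongrightarrow> 1) (at_right 0)"
proof (rule Lim_transform_eventually)
  show "((\<lambda>\<delta>. 6 * r_ex \<delta> / (6 * r_ex \<delta> + 7 * \<delta>)) \<longlongrightarrow> 1) (at_right 0)"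
    unfolding r_ex_def by (rule tendsto_eq_intros refl | simp)+
  have "\<forall>\<^sub>F \<delta> in at_right 0. \<delta> \<in> {0<..<1/4::real}"
    by (rule eventually_at_right_real) simp
  then show "\<forall>\<^sub>F \<delta> in at_right 0. 6 * r_ex \<delta> / (6 * r_ex \<delta> + 7 * \<delta>) =
      (3 * \<delta> / (6 * r_ex \<delta> + 7 * \<delta>)) / (1 - chi_ex \<delta>)"
  proof eventually_elim
    case (elim \<delta>)
    then show ?case
      using r_ex_bounds[of \<delta>] by (simp add: chi_ex_eq)
  qed
qed

theorem theorem4:
  shows
  "(\<forall>\<delta>::real. 0 < \<delta> \<and> \<delta> \<le> 1/4 \<longrightarrow>
      (minimizers (f_ex \<delta>) (B_ex \<delta>) = {xmin_ex \<delta>} \<and>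
       g_ex \<delta> (xmin_ex \<delta>) = vector [0, - \<delta>])
    \<and> (bdd_above ((\<lambda>x. gap_ex \<delta> (C_ex \<delta> x) / gap_ex \<delta> x) `
                    (B_ex \<delta> - minimizers (f_ex \<delta>) (B_ex \<delta>))) \<and>
       chi_ex \<delta> = 1 - \<delta> / (2 * r_ex \<delta>))
    \<and> (x0_ex \<in> B_ex \<delta> - minimizers (f_ex \<delta>) (B_ex \<delta>) \<and>
       gap_ex \<delta> (C_ex \<delta> x0_ex) / gap_ex \<delta> x0_ex = chi_ex \<delta>)
    \<and> ((C_ex \<delta> ^^ (nat \<lceil>r_ex \<delta> / \<delta>\<rceil> + 1)) x0_ex = xmin_ex \<delta> \<and>
       (\<forall>k < nat \<lceil>r_ex \<delta> / \<delta>\<rceil> + 1. (C_ex \<delta> ^^ k) x0_ex \<noteq> xmin_ex \<delta>) \<and>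
       (\<forall>k::nat. int k \<le> \<lfloor>r_ex \<delta> / (2 * \<delta>)\<rfloor> \<longrightarrow>
          gap_ex \<delta> ((C_ex \<delta> ^^ k) x0_ex) > (1/2) * gap_ex \<delta> x0_ex))
    \<and> (strict_lower H_ex = vector [vector [0, 0], vector [1, 0]] \<and>
       invertible (H_ex + (1/2) *\<^sub>R M_scr \<delta>) \<and>
       chi_ex \<delta> \<le> A_half H_ex (M_scr \<delta>) / (1 + A_half H_ex (M_scr \<delta>)) \<and>
       A_half H_ex (M_scr \<delta>) / (1 + A_half H_ex (M_scr \<delta>))
         = 1 - 3 * \<delta> / (6 * r_ex \<delta> + 7 * \<delta>)))
   \<and> ((\<lambda>\<delta>. (3 * \<delta> / (6 * r_ex \<delta> + 7 * \<delta>)) / (1 - chi_ex \<delta>)) \<longlongrightarrow> 1) (at_right 0)"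
  by (intro conjI allI impI rate_ratio_tendsto)
    \<comment> \<open>\<open>funpow.simps\<close> is removed so that the iterate at a successor
      stays folded and \<open>C_ex_iterate_eq_xmin_iff\<close> can match it.\<close>
    (simp_all add: minimizers_ex g_ex_xmin bdd_above_ratio chi_ex_eq x0_ex_mem ratio_x0_ex
      C_ex_iterate_eq_xmin_iff half_gap_less[simplified] strict_lower_H_ex
      inverse_H_plus_half_M_scr(1) rate_le A_half_bound_eq del: funpow.simps)

end
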